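(* Let $N\in\mathbb{N}$, $N\geq 2$, let $(S_j)_{0\leq j<N}$ be a representation of the Cuntz algebra $\mathcal{O}_N$ on a Hilbert space $\mathcal{H}$, and let $P(\cdot)$ be the corresponding projection valued measure on the Borel subsets of $[0,1)$ for the $N$-adic partition system given by the $N$-adic fractions. Let $f\in\mathcal{H}$. Then the Fourier transform $$\hat{\mu}_f(t)=\int_0^1 e^{itx}\,d\mu_f(x),\qquad t\in\mathbb{R},$$ of the measure $\mu_f(\cdot)=\|P(\cdot)f\|^{2}$ satisfies $$\hat{\mu}_f(t)=\sum_{k=0}^{N-1}e^{i\frac{kt}{N}}\ \widehat{\mu_{S_k^{*}f}}(t/N),\qquad t\in\mathbb{R}.$$
   Context: A representation of the Cuntz algebra $\mathcal{O}_N$ on $\mathcal{H}$ is a system $(S_j)_{0\leq j<N}$ of bounded operators on $\mathcal{H}$ with $S_j^{*}S_k=\delta_{j,k}I$ and $\sum_{j=0}^{N-1}S_jS_j^{*}=I$. The $N$-adic partition system is given by the maps $\sigma_j(x)=\frac{x+j}{N}$ on $[0,1)$, $j\in\{0,1,\dots,N-1\}$, so that $\sigma_{\alpha_1}\circ\cdots\circ\sigma_{\alpha_k}([0,1))=\left[\frac{\alpha_1}{N}+\cdots+\frac{\alpha_k}{N^k},\ \frac{\alpha_1}{N}+\cdots+\frac{\alpha_k}{N^k}+\frac{1}{N^k}\right)$. The corresponding projection valued measure $P$ is the (countably additive) Borel measure on $[0,1)$, with values in the orthogonal projections of $\mathcal{H}$, such that $$P\left(\left[\tfrac{\alpha_1}{N}+\cdots+\tfrac{\alpha_k}{N^k},\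 \tfrac{\alpha_1}{N}+\cdots+\tfrac{\alpha_k}{N^k}+\tfrac{1}{N^k}\right)\right)=S_{\alpha_1}\cdots S_{\alpha_k}S_{\alpha_k}^{*}\cdots S_{\alpha_1}^{*}$$ for all $k\ge 1$ and $\alpha_i\in\{0,\dots,N-1\}$. $P$ is taken as given with this property. For every $g\in\mathcal{H}$, $\mu_g(\cdot)=\|P(\cdot)g\|^2$ and $\widehat{\mu_g}(t)=\int_0^1e^{itx}\,d\mu_g(x)$. *)

theory Defs
  imports "HOL-Probability.Characteristic_Functions"
begin

section \<open>Complex Hilbert spaces\<close>

text \<open>
  The inner product is linear in its first argument. The norm, the topology and completeness are
  those of the class \<^class>\<open>banach\<close>, the norm being the one induced by the inner product.
\<close>

class chilbert_space = banach +
  fixes scaleC :: "complex \<Rightarrow> 'a \<Rightarrow> 'a"  (infixr "*\<^sub>C" 75)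
    and cinner :: "'a \<Rightarrow> 'a \<Rightarrow> complex"
  assumes scaleC_add_right: "a *\<^sub>C (x + y) = a *\<^sub>C x + a *\<^sub>C y"
    and scaleC_add_left: "(a + b) *\<^sub>C x = a *\<^sub>C x + b *\<^sub>C x"
    and scaleC_scaleC: "a *\<^sub>C (b *\<^sub>C x) = (a * b) *\<^sub>C x"
    and scaleC_of_real: "complex_of_real r *\<^sub>C x = r *\<^sub>R x"
    and cinner_commute: "cinner x y = cnj (cinner y x)"
    and cinner_add_left: "cinner (x + y) z = cinner x z + cinner y z"
    and cinner_scaleC_left: "cinner (a *\<^sub>C x) y = a * cinner x y"
    and cinner_self: "cinner x x = complex_of_real ((norm x)\<^sup>2)"

definition bounded_clinear :: "('h::chilbert_space \<Rightarrow> 'h) \<Rightarrow> bool" where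
  "bounded_clinear A \<longleftrightarrow> bounded_linear A \<and> (\<forall>c x. A (c *\<^sub>C x) = c *\<^sub>C A x)"

text \<open>
  For a bounded operator the adjoint exists by the Riesz representation theorem, and it is unique
  because the inner product is definite; for other functions the value is unspecified.
\<close>

definition cadjoint :: "('h::chilbert_space \<Rightarrow> 'h) \<Rightarrow> 'h \<Rightarrow> 'h" where
  "cadjoint A = (SOME B. \<forall>x y. cinner (A x) y = cinner x (B y))"

definition orthogonal_projection :: "('h::chilbert_space \<Rightarrow> 'h) \<Rightarrow> bool" where
  "orthogonal_projection Q \<longleftrightarrow> bounded_clinear Q \<and> Q \<circ> Q = Q \<and> cadjoint Q = Q"


section \<open>Representations of the Cuntz algebra\<close>

definition cuntz_representation :: "nat \<Rightarrow> (nat \<Rightarrow> 'h::chilbert_space \<Rightarrow> 'h) \<Rightarrow> bool" where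
  "cuntz_representation N S \<longleftrightarrow>
     (\<forall>j<N. bounded_clinear (S j)) \<and>
     (\<forall>j<N. \<forall>k<N. cadjoint (S j) \<circ> S k = (if j = k then id else (\<lambda>_. 0))) \<and>
     (\<forall>x. (\<Sum>j<N. S j (cadjoint (S j) x)) = x)"


section \<open>The projection valued measure of the N-adic partition system\<close>

definition nadic_map :: "nat \<Rightarrow> nat \<Rightarrow> real \<Rightarrow> real" where
  "nadic_map N j x = (x + real j) / real N"

definition nadic_left :: "nat \<Rightarrow> nat list \<Rightarrow> real" where
  "nadic_left N \<alpha> = (\<Sum>i<length \<alpha>. real (\<alpha> ! i) / real N ^ (i + 1))"

definition nadic_interval :: "nat \<Rightarrow> nat list \<Rightarrow> real set" where
  "nadic_interval N \<alpha> = {nadic_left N \<alpha> ..< nadic_left N \<alpha> + 1 / real N ^ length \<alpha>}"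

lemma nadic_left_Cons: "nadic_left N (j # \<alpha>) = nadic_map N j (nadic_left N \<alpha>)"
  by (simp add: nadic_left_def nadic_map_def sum.lessThan_Suc_shift sum_divide_distrib
      add_divide_distrib mult.commute del: sum.lessThan_Suc)

lemma nadic_map_image:
  assumes "N > 0"
  shows "nadic_map N j ` {a..<b} = {nadic_map N j a..<nadic_map N j b}"
proof
  show "nadic_map N j ` {a..<b} \<subseteq> {nadic_map N j a..<nadic_map N j b}"
    using assms by (auto simp: nadic_map_def divide_simps)
  show "{nadic_map N j a..<nadic_map N j b} \<subseteq> nadic_map N j ` {a..<b}"
  proof
    fix y assume "y \<in> {nadic_map N j a..<nadic_map N j b}"
    then have "y * real N - real j \<in> {a..<b}" "y = nadic_map N j (y * real N - real j)"
      using assms by (auto simp: nadic_map_def field_simps)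
    then show "y \<in> nadic_map N j ` {a..<b}" by blast
  qed
qed

lemma nadic_interval_eq_image:
  assumes "N > 0"
  shows "nadic_interval N \<alpha> = foldr (\<circ>) (map (nadic_map N) \<alpha>) id ` {0..<1}"
proof (induction \<alpha>)
  case Nil
  show ?case by (simp add: nadic_interval_def nadic_left_def)
next
  case (Cons j \<alpha>)
  have "nadic_map N j ` nadic_interval N \<alpha> = nadic_interval N (j # \<alpha>)"
    using assms
    by (simp add: nadic_interval_def nadic_map_image nadic_left_Cons)
       (simp add: nadic_map_def add_divide_distrib mult.commute add.commute add.left_commute)
  then show ?case by (simp add: Cons.IH image_image)
qed

text \<open>\<open>S\<^sub>\<alpha>\<^sub>1 \<cdots> S\<^sub>\<alpha>\<^sub>k S\<^sub>\<alpha>\<^sub>k\<^sup>* \<cdots> S\<^sub>\<alpha>\<^sub>1\<^sup>*\<close>\<close>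

definition cuntz_range_projection ::
    "(nat \<Rightarrow> 'h::chilbert_space \<Rightarrow> 'h) \<Rightarrow> nat list \<Rightarrow> 'h \<Rightarrow> 'h" where
  "cuntz_range_projection S \<alpha> =
     foldr (\<circ>) (map S \<alpha>) id \<circ> foldr (\<circ>) (map (\<lambda>j. cadjoint (S j)) (rev \<alpha>)) id"

abbreviation borel01 :: "real measure" where
  "borel01 \<equiv> restrict_space borel {0..<1}"

text \<open>Countable additivity is meant in the strong operator topology.\<close>

definition projection_valued_measure ::
    "'x measure \<Rightarrow> ('x set \<Rightarrow> 'h::chilbert_space \<Rightarrow> 'h) \<Rightarrow> bool" where
  "projection_valued_measure M P \<longleftrightarrow>
     (\<forall>E \<in> sets M. orthogonal_projection (P E)) \<and>
     (\<forall>A :: nat \<Rightarrow> 'x set. range A \<subseteq> sets M \<longrightarrow> disjoint_family A \<longrightarrow>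
        (\<forall>g. (\<lambda>i. P (A i) g) sums P (\<Union>i. A i) g))"

definition nadic_pvm ::
    "nat \<Rightarrow> (nat \<Rightarrow> 'h::chilbert_space \<Rightarrow> 'h) \<Rightarrow> (real set \<Rightarrow> 'h \<Rightarrow> 'h) \<Rightarrow> bool" where
  "nadic_pvm N S P \<longleftrightarrow>
     projection_valued_measure borel01 P \<and>
     (\<forall>\<alpha>. \<alpha> \<noteq> [] \<longrightarrow> set \<alpha> \<subseteq> {..<N} \<longrightarrow>
        P (nadic_interval N \<alpha>) = cuntz_range_projection S \<alpha>)"

definition pvm_measure :: "(real set \<Rightarrow> 'h::chilbert_space \<Rightarrow> 'h) \<Rightarrow> 'h \<Rightarrow> real measure" where
  "pvm_measure P g = measure_of {0..<1} (sets borel01) (\<lambda>E. ennreal ((norm (P E g))\<^sup>2))"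

end

theory Submission
  imports Defs
begin

text \<open>
  The characteristic function of \<open>\<mu>\<^sub>f\<close> is the limit of its Riemann sums over the N-adic intervals
  of length \<open>N\<^sup>-\<^sup>n\<close>. On these intervals \<open>\<mu>\<^sub>f\<close> is explicit: since \<open>S\<^sub>k\<close> is isometric,
  the interval of the word \<open>k\<alpha>\<close> has the same \<open>\<mu>\<^sub>f\<close>-mass as the interval of \<open>\<alpha>\<close> has under the
  measure of \<open>S\<^sub>k\<^sup>*f\<close>, and its left endpoint is \<open>(x\<^sub>\<alpha> + k) / N\<close>. Hence the identity holds exactly
  between Riemann sums of consecutive levels, and passes to the limit.
\<close>

section \<open>Adjoints in complex Hilbert spaces\<close>

lemma cinner_add_right: "cinner x (y + z) = cinner x y + cinner x (z::'a::chilbert_space)"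
  by (metis cinner_add_left cinner_commute complex_cnj_add)

lemma cinner_scaleR_left: "cinner (r *\<^sub>R x) y = r *\<^sub>R cinner x (y::'a::chilbert_space)"
  by (metis cinner_scaleC_left scaleC_of_real scaleR_conv_of_real)

lemma cinner_scaleR_right: "cinner x (r *\<^sub>R y) = r *\<^sub>R cinner x (y::'a::chilbert_space)"
  by (metis cinner_scaleR_left cinner_commute complex_cnj_scaleR)

lemma norm_add_squared:
  fixes x y :: "'a::chilbert_space"
  shows "(norm (x + y))\<^sup>2 = (norm x)\<^sup>2 + 2 * Re (cinner x y) + (norm y)\<^sup>2"
proof -
  have "complex_of_real ((norm (x + y))\<^sup>2) = cinner (x + y) (x + y)"
    by (simp add: cinner_self)
  also have "Re \<dots> = Re (cinner x x) + Re (cinner x y) + Re (cinner y x) + Re (cinner y y)"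
    by (simp add: cinner_add_left cinner_add_right)
  also have "Re (cinner y x) = Re (cinner x y)"
    by (metis cinner_commute complex_cnj(1) complex.sel(1) complex.exhaust_sel)
  finally show ?thesis
    by (simp add: cinner_self)
qed

text \<open>The norm and its triangle inequality come with the class, so squaring that inequality
  and cancelling the squares yields the Cauchy-Schwarz bound.\<close>

lemma Re_cinner_le: "Re (cinner x y) \<le> norm x * norm (y::'a::chilbert_space)"
proof -
  have "(norm (x + y))\<^sup>2 \<le> (norm x + norm y)\<^sup>2"
    by (intro power_mono norm_triangle_ineq norm_ge_zero)
  then show ?thesis
    by (simp add: norm_add_squared power2_sum)
qed

lemma abs_Re_cinner_le: "\<bar>Re (cinner x y)\<bar> \<le> norm x * norm (y::'a::chilbert_space)"
  using Re_cinner_le[of x y] Re_cinner_le[of "(-1) *\<^sub>R x" y]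
  by (simp only: cinner_scaleR_left) (auto simp: abs_le_iff)

lemma bounded_linear_Re_cinner:
  "bounded_linear (\<lambda>x. Re (cinner x (y::'a::chilbert_space)))"
  by (rule bounded_linear_intro[where K = "norm y"])
     (simp_all add: cinner_add_left cinner_scaleR_left abs_Re_cinner_le)

text \<open>First-order condition at a minimum: for small \<open>r\<close> of the right sign the
  linear term would dominate and make the expression negative.\<close>

lemma linear_coefficient_zero:
  fixes a b :: real
  assumes "\<And>r. 0 \<le> r * a + r\<^sup>2 * b"
  shows "a = 0"
proof (rule ccontr)
  assume "a \<noteq> 0"
  \<comment> \<open>Any positive \<open>c\<close> above \<open>b\<close> works: at
    \<open>r = - a / c\<close> the expression equals \<open>(a / c)^2 * (b - c)\<close>.\<close>
  define c where "c = \<bar>b\<bar> + 1"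
  have c: "c > 0" "b < c" by (auto simp: c_def)
  have "0 \<le> (- a / c) * a + (- a / c)\<^sup>2 * b" by (rule assms)
  also have "\<dots> = (a\<^sup>2 / c\<^sup>2) * (b - c)"
    using c by (simp add: field_simps power2_eq_square)
  also have "\<dots> < 0"
    using c \<open>a \<noteq> 0\<close> by (intro mult_pos_neg) auto
  finally show False by simp
qed

text \<open>The representing vector minimises \<open>\<parallel>x\<parallel>\<^sup>2 - 2 \<phi> x\<close>; the parallelogram law makes
  minimising sequences Cauchy.\<close>

lemma Riesz_representation_real:
  fixes \<phi> :: "'a::chilbert_space \<Rightarrow> real"
  assumes "bounded_linear \<phi>"
  shows "\<exists>z. \<forall>x. \<phi> x = Re (cinner x z)"
proof -
  interpret \<phi>: bounded_linear \<phi> by fact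
  define J where "J x = (norm x)\<^sup>2 - 2 * \<phi> x" for x
  obtain C where C: "\<And>x. norm (\<phi> x) \<le> norm x * C"
    using \<phi>.bounded by blast
  \<comment> \<open>Completing the square against the bound \<open>C\<close> for
    \<open>\<phi>\<close> makes the infimum \<open>m\<close> finite.\<close>
  have lower: "- C\<^sup>2 \<le> J x" for x
  proof -
    have "0 \<le> (norm x - C)\<^sup>2" by simp
    also have "\<dots> = (norm x)\<^sup>2 - 2 * (norm x * C) + C\<^sup>2"
      by (simp add: power2_diff)
    finally show ?thesis using C[of x] by (simp add: J_def)
  qed
  define m where "m = (INF x. J x)"
  have bdd: "bdd_below (range J)" using lower by (auto intro!: bdd_belowI[of _ "- C\<^sup>2"])
  have m_le: "m \<le> J x" for x
    unfolding m_def by (rule cINF_lower[OF bdd]) simp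
  have "\<exists>x. J x < m + 1 / real (Suc n)" for n
    using cINF_less_iff[OF _ bdd, of "m + 1 / real (Suc n)"] by (simp add: m_def)
  then obtain X where X: "\<And>n. J (X n) < m + 1 / real (Suc n)" by metis
  \<comment> \<open>The linear parts cancel because \<open>\<phi>\<close> at the midpoint is the
    average of its values. As \<open>J\<close> is at least \<open>m\<close> at the midpoint, two
    near-minimisers must be close.\<close>
  have parallelogram: "(norm (x - y))\<^sup>2 = 2 * J x + 2 * J y - 4 * J ((1/2) *\<^sub>R (x + y))" for x y
  proof -
    have "(norm (x - y))\<^sup>2 = (norm x)\<^sup>2 - 2 * Re (cinner x y) + (norm y)\<^sup>2"
      using norm_add_squared[of x "(-1) *\<^sub>R y"] by (simp only: cinner_scaleR_right) simp
    moreover have "(norm ((1/2) *\<^sub>R (x + y)))\<^sup>2 = (1/4) * (norm (x + y))\<^sup>2"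
      by (simp add: power_mult_distrib power2_eq_square)
    moreover have "\<phi> ((1/2) *\<^sub>R (x + y)) = (1/2) * (\<phi> x + \<phi> y)"
      by (simp only: \<phi>.scaleR \<phi>.add real_scaleR_def)
    ultimately show ?thesis
      using norm_add_squared[of x y] by (simp only: J_def) argo
  qed
  have "Cauchy X"
  proof (rule metric_CauchyI)
    fix e :: real assume "e > 0"
    \<comment> \<open>The excesses over \<open>m\<close> enter the identity with factor 2 each, so
      two of them below \<open>e^2 / 4\<close> suffice.\<close>
    then obtain M where M: "inverse (real (Suc M)) < e\<^sup>2 / 4"
      using reals_Archimedean[of "e\<^sup>2 / 4"] by auto
    show "\<exists>M. \<forall>i\<ge>M. \<forall>j\<ge>M. dist (X i) (X j) < e"
    proof (intro exI allI impI)
      fix i j assume "i \<ge> M" "j \<ge> M"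
      then have "1 / real (Suc i) \<le> inverse (real (Suc M))" "1 / real (Suc j) \<le> inverse (real (Suc M))"
        by (auto simp: field_simps)
      then have "(norm (X i - X j))\<^sup>2 < e\<^sup>2"
        using parallelogram[of "X i" "X j"] X[of i] X[of j] m_le[of "(1/2) *\<^sub>R (X i + X j)"] M
        by linarith
      then show "dist (X i) (X j) < e"
        using \<open>e > 0\<close> by (simp add: dist_norm power_less_imp_less_base)
    qed
  qed
  then obtain z where z: "X \<longlonglongrightarrow> z"
    using Cauchy_convergent convergent_def by blast
  have "(\<lambda>n. J (X n)) \<longlonglongrightarrow> J z"
    unfolding J_def by (intro tendsto_intros z \<phi>.tendsto)
  moreover have "(\<lambda>n. m + 1 / real (Suc n)) \<longlonglongrightarrow> m + 0"
    by (intro tendsto_intros LIMSEQ_Suc[OF lim_1_over_n])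
  ultimately have "J z \<le> m"
    using X by (intro LIMSEQ_le[of "\<lambda>n. J (X n)" "J z" "\<lambda>n. m + 1 / real (Suc n)"])
      (auto intro: less_imp_le)
  have "\<phi> x = Re (cinner x z)" for x
  proof -
    \<comment> \<open>Moving from the minimiser \<open>z\<close> by \<open>r\<close> times
      \<open>x\<close> changes \<open>J\<close> by this quadratic in \<open>r\<close>, whose linear
      coefficient must vanish.\<close>
    have "0 \<le> r * (2 * Re (cinner x z) - 2 * \<phi> x) + r\<^sup>2 * (norm x)\<^sup>2" for r
    proof -
      have "J z \<le> J (r *\<^sub>R x + z)" using \<open>J z \<le> m\<close> m_le order_trans by blast
      then show ?thesis
        unfolding J_def norm_add_squared \<phi>.scaleR \<phi>.add cinner_scaleR_left
        by (simp add: power_mult_distrib algebra_simps)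
    qed
    from linear_coefficient_zero[OF this] show ?thesis by simp
  qed
  then show ?thesis by blast
qed

text \<open>\<open>cadjoint\<close> is a choice term, so its defining identity becomes available
  only once an adjoint is shown to exist; the real Riesz theorem supplies its value at each
  \<open>y\<close>.\<close>

lemma cinner_cadjoint:
  assumes "bounded_clinear A"
  shows "cinner (A x) y = cinner x (cadjoint A y)"
proof -
  have A: "bounded_linear A" "\<And>c x. A (c *\<^sub>C x) = c *\<^sub>C A x"
    using assms by (auto simp: bounded_clinear_def)
  have "\<exists>z. \<forall>x. cinner (A x) y = cinner x z" for y
  proof -
    have "bounded_linear (\<lambda>x. Re (cinner (A x) y))"
      by (rule bounded_linear_compose[OF bounded_linear_Re_cinner A(1)])
    then obtain z where z: "\<And>x. Re (cinner (A x) y) = Re (cinner x z)"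
      using Riesz_representation_real by blast
    \<comment> \<open>The real parts at \<open>\<i> *\<^sub>C x\<close> are the negated imaginary
      parts at \<open>x\<close>.\<close>
    have "Im (cinner (A x) y) = Im (cinner x z)" for x
      using z[of "\<i> *\<^sub>C x"] by (simp add: A cinner_scaleC_left)
    with z show ?thesis by (auto intro!: exI[of _ z] complex_eqI)
  qed
  then have "\<exists>B. \<forall>x y. cinner (A x) y = cinner x (B y)" by metis
  then show ?thesis
    unfolding cadjoint_def by (rule someI2_ex) blast
qed

lemma norm_isometry_of_cadjoint:
  assumes "bounded_clinear A" "cadjoint A \<circ> A = id"
  shows "norm (A x) = norm x"
proof -
  have "cinner (A x) (A x) = cinner x x"
    using assms by (simp add: cinner_cadjoint fun_eq_iff)
  then have "(norm (A x))\<^sup>2 = (norm x)\<^sup>2"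
    unfolding cinner_self of_real_eq_iff .
  then show ?thesis by simp
qed

text \<open>The right-hand side is real-linear and continuous in \<open>Q g\<close>, so strong
  convergence of a series of projections passes to the squared norms.\<close>

lemma norm_orthogonal_projection_squared:
  assumes "orthogonal_projection Q"
  shows "(norm (Q g))\<^sup>2 = Re (cinner (Q g) g)"
proof -
  have Q: "bounded_clinear Q" "\<And>x. Q (Q x) = Q x" "cadjoint Q = Q"
    using assms by (auto simp: orthogonal_projection_def fun_eq_iff)
  have "cinner (Q g) g = cinner (Q g) (Q g)"
    using cinner_cadjoint[OF Q(1), of "Q g" g] Q(2,3) by simp
  then show ?thesis by (simp add: cinner_self)
qed

section \<open>The scalar measures of a projection valued measure\<close>

lemma pvm_countably_additive:
  assumes "projection_valued_measure M P"
  shows "countably_additive (sets M) (\<lambda>E. ennreal ((norm (P E g))\<^sup>2))"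
  unfolding countably_additive_def
proof (intro allI impI)
  fix A :: "nat \<Rightarrow> _"
  assume A: "range A \<subseteq> sets M" "disjoint_family A" "(\<Union>i. A i) \<in> sets M"
  have proj: "(norm (P E g))\<^sup>2 = Re (cinner (P E g) g)" if "E \<in> sets M" for E
    using assms that by (auto simp: projection_valued_measure_def
        intro: norm_orthogonal_projection_squared)
  have "(\<lambda>i. P (A i) g) sums P (\<Union>i. A i) g"
    using assms A by (auto simp: projection_valued_measure_def)
  from bounded_linear.sums[OF bounded_linear_Re_cinner[of g] this]
  have "(\<lambda>i. (norm (P (A i) g))\<^sup>2) sums (norm (P (\<Union>i. A i) g))\<^sup>2"
    using A by (simp add: proj range_subsetD)
  then show "(\<Sum>i. ennreal ((norm (P (A i) g))\<^sup>2)) = ennreal ((norm (P (\<Union>i. A i) g))\<^sup>2)"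
    by (intro suminf_ennreal_eq) auto
qed

text \<open>The constant family of empty sets is disjoint, so its values form a convergent series
  with constant terms, which must be zero.\<close>

lemma pvm_empty:
  assumes "projection_valued_measure M P"
  shows "P {} g = 0"
proof -
  define A :: "nat \<Rightarrow> 'a set" where "A = (\<lambda>_. {})"
  have "range A \<subseteq> sets M" "disjoint_family A"
    by (auto simp: A_def disjoint_family_on_def)
  then have "(\<lambda>i. P (A i) g) sums P (\<Union>i. A i) g"
    using assms by (simp add: projection_valued_measure_def)
  then have "(\<lambda>i. P (A i) g) \<longlonglongrightarrow> 0"
    using sums_summable summable_LIMSEQ_zero by blast
  then show ?thesis by (simp add: A_def LIMSEQ_const_iff)
qed

lemma sets_pvm_measure [measurable_cong]: "sets (pvm_measure P g) = sets borel01"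
  and space_pvm_measure: "space (pvm_measure P g) = {0..<1}"
proof -
  have "sets borel01 \<subseteq> Pow {0..<1::real}"
    using sets.space_closed[of borel01] by (simp add: space_restrict_space)
  moreover have "sigma_sets {0..<1::real} (sets borel01) = sets borel01"
    using sets.sigma_sets_eq[of borel01] by (simp add: space_restrict_space)
  ultimately show "sets (pvm_measure P g) = sets borel01" "space (pvm_measure P g) = {0..<1}"
    by (simp_all add: pvm_measure_def sets_measure_of space_measure_of)
qed

text \<open>\<open>measure_of\<close> takes the prescribed values only for a positive, countably
  additive set function on a sigma-algebra; these conditions are discharged here.\<close>

lemma emeasure_pvm_measure:
  assumes "projection_valued_measure borel01 P" "E \<in> sets borel01"
  shows "emeasure (pvm_measure P g) E = ennreal ((norm (P E g))\<^sup>2)"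
  unfolding pvm_measure_def
proof (rule emeasure_measure_of_sigma)
  show "sigma_algebra {0..<1::real} (sets borel01)"
    using sets.sigma_algebra_axioms[of borel01] by (simp add: space_restrict_space)
  show "positive (sets borel01) (\<lambda>E. ennreal ((norm (P E g))\<^sup>2))"
    using pvm_empty[OF assms(1)] by (simp add: positive_def)
qed (use assms pvm_countably_additive in auto)

lemma measure_pvm_measure:
  assumes "projection_valued_measure borel01 P" "E \<in> sets borel01"
  shows "measure (pvm_measure P g) E = (norm (P E g))\<^sup>2"
  by (simp add: measure_def emeasure_pvm_measure[OF assms])

lemma finite_measure_pvm_measure:
  assumes "projection_valued_measure borel01 P"
  shows "finite_measure (pvm_measure P g)"
  using sets.top[of borel01]
  by (intro finite_measureI)
     (simp add: space_pvm_measure emeasure_pvm_measure[OF assms] space_restrict_space)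

section \<open>Riemann sums for characteristic functions\<close>

text \<open>Factoring out the unimodular \<open>iexp b\<close> leaves the zeroth-order Taylor
  estimate of the exponential.\<close>

lemma cmod_iexp_diff_le: "cmod (iexp a - iexp b) \<le> \<bar>a - b\<bar>"
proof -
  have "iexp a - iexp b = iexp b * (iexp (a - b) - 1)"
    by (simp add: algebra_simps flip: exp_add)
  then have "cmod (iexp a - iexp b) = cmod (iexp (a - b) - 1)"
    by (simp add: norm_mult)
  also have "\<dots> \<le> \<bar>a - b\<bar>"
    using iexp_approx1[of "a - b" 0] by simp
  finally show ?thesis .
qed

text \<open>The sum is the integral of a step function that differs from the integrand by at most
  \<open>\<bar>t\<bar> * \<delta>\<close> everywhere. Measurability of the identity is a hypothesis
  because \<open>M\<close> may carry a sigma-algebra other than \<open>borel\<close>.\<close>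

lemma char_Riemann_sum:
  fixes M :: "real measure"
  assumes "finite_measure M" and id_meas: "(\<lambda>x. x) \<in> borel_measurable M"
    and "finite I" and A: "\<And>i. i \<in> I \<Longrightarrow> A i \<in> sets M"
    and disj: "disjoint_family_on A I" and cover: "(\<Union>i\<in>I. A i) = space M"
    and near: "\<And>i x. i \<in> I \<Longrightarrow> x \<in> A i \<Longrightarrow> \<bar>x - c i\<bar> \<le> \<delta>"
  shows "cmod (char M t - (\<Sum>i\<in>I. iexp (t * c i) * measure M (A i))) \<le> \<bar>t\<bar> * \<delta> * measure M (space M)"
proof -
  interpret finite_measure M by fact
  define s where "s x = (\<Sum>i\<in>I. indicator (A i) x *\<^sub>R iexp (t * c i))" for x
  have s_int: "integrable M s"
    unfolding s_def using A by (intro Bochner_Integration.integrable_sum integrable_indicator)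
      (auto simp: less_top[symmetric])
  have s_val: "integral\<^sup>L M s = (\<Sum>i\<in>I. iexp (t * c i) * measure M (A i))"
    unfolding s_def using A sets.sets_into_space
    by (subst Bochner_Integration.integral_sum)
       (auto intro!: integrable_indicator sum.cong
          simp: less_top[symmetric] scaleR_conv_of_real mult.commute Int_absorb1 Int_absorb2)
  have e_int: "integrable M (\<lambda>x. iexp (t * x))"
    using id_meas by (intro integrable_const_bound[of _ 1]) auto
  have bound: "cmod (iexp (t * x) - s x) \<le> \<bar>t\<bar> * \<delta>" if x: "x \<in> space M" for x
  proof -
    obtain i where i: "i \<in> I" "x \<in> A i" using x cover by blast
    \<comment> \<open>By disjointness only the cell containing \<open>x\<close> contributes.\<close>
    have "s x = (\<Sum>j\<in>I. if j = i then iexp (t * c i) else 0)"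
      unfolding s_def
    proof (intro sum.cong refl)
      fix j assume "j \<in> I"
      then have "indicator (A j) x = (if j = i then 1 else 0 :: real)"
        using disjoint_family_onD[OF disj \<open>j \<in> I\<close> i(1)] i(2) by (auto simp: indicator_def)
      then show "indicator (A j) x *\<^sub>R iexp (t * c j) = (if j = i then iexp (t * c i) else 0)"
        by simp
    qed
    then have "s x = iexp (t * c i)" using i \<open>finite I\<close> by simp
    then have "cmod (iexp (t * x) - s x) \<le> \<bar>t * x - t * c i\<bar>"
      by (metis cmod_iexp_diff_le)
    also have "\<dots> = \<bar>t\<bar> * \<bar>x - c i\<bar>" by (simp add: abs_mult flip: right_diff_distrib)
    also have "\<dots> \<le> \<bar>t\<bar> * \<delta>" using near[OF i] by (intro mult_left_mono) auto
    finally show ?thesis .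
  qed
  have "char M t - (\<Sum>i\<in>I. iexp (t * c i) * measure M (A i)) = (\<integral>x. iexp (t * x) - s x \<partial>M)"
    unfolding char_def s_val[symmetric] using e_int s_int by simp
  also have "cmod \<dots> \<le> (\<integral>x. cmod (iexp (t * x) - s x) \<partial>M)"
    by (rule integral_norm_bound)
  also have "\<dots> \<le> (\<integral>x. \<bar>t\<bar> * \<delta> \<partial>M)"
    using bound by (intro integral_mono Bochner_Integration.integrable_norm
        Bochner_Integration.integrable_diff e_int s_int) auto
  also have "\<dots> = \<bar>t\<bar> * \<delta> * measure M (space M)" by simp
  finally show ?thesis .
qed

section \<open>N-adic intervals\<close>

definition words :: "nat \<Rightarrow> nat \<Rightarrow> nat list set" where
  "words N n = {\<alpha>. set \<alpha> \<subseteq> {..<N} \<and> length \<alpha> = n}"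

lemma finite_words: "finite (words N n)"
  by (simp add: words_def finite_lists_length_eq)

lemma words_Suc: "words N (Suc n) = (\<lambda>(k, \<alpha>). k # \<alpha>) ` ({..<N} \<times> words N n)"
  by (auto simp: words_def length_Suc_conv image_iff)

lemma sum_words_Suc: "(\<Sum>\<beta>\<in>words N (Suc n). h \<beta>) = (\<Sum>k<N. \<Sum>\<alpha>\<in>words N n. h (k # \<alpha>))"
  unfolding words_Suc
  by (subst sum.reindex) (auto simp: inj_on_def sum.cartesian_product intro!: sum.cong)

lemma nadic_interval_Cons:
  assumes "N > 0"
  shows "nadic_interval N (k # \<alpha>) = nadic_map N k ` nadic_interval N \<alpha>"
  using assms by (simp add: nadic_interval_eq_image image_comp)

lemma nadic_interval_subset:
  assumes "\<alpha> \<in> words N n"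
  shows "nadic_interval N \<alpha> \<subseteq> {0..<1}"
  using assms
proof (induction n arbitrary: \<alpha>)
  case 0
  then show ?case by (simp add: words_def nadic_interval_def nadic_left_def)
next
  case (Suc n)
  then obtain k \<beta> where k: "\<alpha> = k # \<beta>" "k < N" "\<beta> \<in> words N n"
    by (auto simp: words_Suc)
  then have "real k + 1 \<le> real N" by linarith
  then have "nadic_map N k x \<in> {0..<1}" if "x \<in> {0..<1}" for x
    using that k by (auto simp: nadic_map_def field_simps)
  then show ?case using Suc.IH[OF k(3)] k by (auto simp: nadic_interval_Cons)
qed

text \<open>The digit and the argument are the integer and fractional parts of \<open>N\<close>
  times the common value.\<close>

lemma nadic_map_eq_imp:
  assumes "nadic_map N j x = nadic_map N k y" "N > 0" "x \<in> {0..<1}" "y \<in> {0..<1}"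
  shows "j = k \<and> x = y"
proof -
  have "x + real j = y + real k" using assms by (simp add: nadic_map_def)
  moreover from this have "real j < real k + 1" "real k < real j + 1"
    using assms(3,4) by auto
  ultimately have "j = k" by linarith
  with \<open>x + real j = y + real k\<close> show ?thesis by simp
qed

lemma nadic_interval_disjoint:
  assumes "N > 0"
  shows "disjoint_family_on (nadic_interval N) (words N n)"
proof (induction n)
  case 0
  then show ?case by (auto simp: words_def disjoint_family_on_def)
next
  case (Suc n)
  show ?case
    unfolding disjoint_family_on_def
  proof (intro ballI impI)
    fix \<alpha> \<beta> assume "\<alpha> \<in> words N (Suc n)" "\<beta> \<in> words N (Suc n)" and ne: "\<alpha> \<noteq> \<beta>"
    then obtain j \<alpha>' k \<beta>' where w: "\<alpha> = j # \<alpha>'" "\<beta> = k # \<beta>'" "\<alpha>' \<in> words N n" "\<beta>' \<in> words N n"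
      by (auto simp: words_Suc)
    have False if "x \<in> nadic_interval N \<alpha>'" "y \<in> nadic_interval N \<beta>'"
      "nadic_map N j x = nadic_map N k y" for x y
    proof -
      have "j = k \<and> x = y"
        using that w nadic_interval_subset assms by (intro nadic_map_eq_imp[of N]) blast+
      then show False using that w ne Suc.IH by (auto simp: disjoint_family_on_def)
    qed
    then show "nadic_interval N \<alpha> \<inter> nadic_interval N \<beta> = {}"
      using assms w by (auto simp: nadic_interval_Cons)
  qed
qed

lemma nadic_interval_cover:
  assumes "N > 0"
  shows "(\<Union>\<alpha>\<in>words N n. nadic_interval N \<alpha>) = {0..<1}"
proof (induction n)
  case 0
  then show ?case by (simp add: words_def nadic_interval_def nadic_left_def)
next
  case (Suc n)
  have "x \<in> (\<Union>\<alpha>\<in>words N (Suc n). nadic_interval N \<alpha>)" if x: "x \<in> {0..<1}" for x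
  proof -
    \<comment> \<open>\<open>k\<close> is the leading N-adic digit of \<open>x\<close>; the
      remainder \<open>N * x - k\<close> lies in the unit interval and gets its word of length
      \<open>n\<close> from the induction hypothesis.\<close>
    define k where "k = nat \<lfloor>real N * x\<rfloor>"
    have k: "real k \<le> real N * x" "real N * x < real k + 1"
      using x by (auto simp: k_def)
    have "real N * x < real N" using x assms by simp
    then have "k < N" using k by linarith
    have "real N * x - real k \<in> {0..<1}" using k by auto
    then obtain \<alpha> where \<alpha>: "\<alpha> \<in> words N n" "real N * x - real k \<in> nadic_interval N \<alpha>"
      using Suc.IH by blast
    moreover have "x = nadic_map N k (real N * x - real k)"
      using assms by (simp add: nadic_map_def)
    ultimately have "x \<in> nadic_interval N (k # \<alpha>)"
      using assms by (auto simp: nadic_interval_Cons)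
    then show ?thesis using \<alpha> \<open>k < N\<close> by (force simp: words_Suc)
  qed
  then show ?case using nadic_interval_subset by blast
qed

lemma nadic_interval_near_left:
  assumes "x \<in> nadic_interval N \<alpha>"
  shows "\<bar>x - nadic_left N \<alpha>\<bar> \<le> 1 / real N ^ length \<alpha>"
  using assms by (auto simp: nadic_interval_def)

lemma sets_nadic_interval:
  assumes "\<alpha> \<in> words N n"
  shows "nadic_interval N \<alpha> \<in> sets borel01"
  using nadic_interval_subset[OF assms]
  by (subst sets_restrict_space_iff) (auto simp: nadic_interval_def)

section \<open>Convergence of the N-adic Riemann sums\<close>

lemma char_pvm_measure_LIMSEQ:
  assumes "N \<ge> 2" "projection_valued_measure borel01 P"
  shows "(\<lambda>n. \<Sum>\<alpha>\<in>words N n. iexp (t * nadic_left N \<alpha>) * (norm (P (nadic_interval N \<alpha>) g))\<^sup>2)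
    \<longlonglongrightarrow> char (pvm_measure P g) t"
proof -
  define M where "M = pvm_measure P g"
  define R where "R n = (\<Sum>\<alpha>\<in>words N n. iexp (t * nadic_left N \<alpha>)
    * measure M (nadic_interval N \<alpha>))" for n
  have N: "N > 0" using assms by simp
  have meas: "(\<lambda>x. x) \<in> borel_measurable M"
    by (simp add: M_def measurable_cong_sets[OF sets_pvm_measure refl] measurable_restrict_space1)
  have bound: "cmod (char M t - R n) \<le> \<bar>t\<bar> * (1 / real N ^ n) * measure M (space M)" for n
    unfolding R_def
    by (rule char_Riemann_sum)
       (use finite_measure_pvm_measure[OF assms(2)] meas finite_words sets_nadic_interval
          nadic_interval_disjoint[OF N] nadic_interval_cover[OF N] nadic_interval_near_left
        in \<open>auto simp: M_def sets_pvm_measure space_pvm_measure words_def\<close>)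
  \<comment> \<open>The total mass is fixed, while the mesh tends to zero because \<open>N\<close>
    is at least 2.\<close>
  have "(\<lambda>n. \<bar>t\<bar> * (1 / real N ^ n) * measure M (space M)) \<longlonglongrightarrow> \<bar>t\<bar> * 0 * measure M (space M)"
    using LIMSEQ_divide_realpow_zero[of "real N" 1] assms(1) by (intro tendsto_intros) auto
  then have "(\<lambda>n. \<bar>t\<bar> * (1 / real N ^ n) * measure M (space M)) \<longlonglongrightarrow> 0"
    by simp
  then have "(\<lambda>n. char M t - R n) \<longlonglongrightarrow> 0"
    by (rule Lim_null_comparison[OF always_eventually, rotated]) (use bound in blast)
  then have "(\<lambda>n. char M t - (char M t - R n)) \<longlonglongrightarrow> char M t - 0"
    by (intro tendsto_intros)
  moreover have "R n = (\<Sum>\<alpha>\<in>words N n. iexp (t * nadic_left N \<alpha>)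
      * (norm (P (nadic_interval N \<alpha>) g))\<^sup>2)" for n
    unfolding R_def M_def
    by (intro sum.cong refl) (simp add: measure_pvm_measure[OF assms(2)] sets_nadic_interval)
  ultimately show ?thesis by (simp add: M_def)
qed

section \<open>Self-similarity of the masses under the Cuntz isometries\<close>

lemma foldr_comp_append:
  "foldr (\<circ>) (fs @ gs) id x = foldr (\<circ>) fs id (foldr (\<circ>) gs id x)"
  by (induction fs) auto

text \<open>Reversing the word in the adjoint block makes the adjoint of the first letter act first,
  while its isometry acts last.\<close>

lemma cuntz_range_projection_Cons:
  "cuntz_range_projection S (k # \<alpha>) g = S k (cuntz_range_projection S \<alpha> (cadjoint (S k) g))"
  by (simp add: cuntz_range_projection_def foldr_comp_append del: foldr_append)

text \<open>The outer isometry \<open>S k\<close> drops out of the norm. The length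
  \<open>Suc n\<close> keeps \<open>\<alpha>\<close> nonempty, since \<open>nadic_pvm\<close>
  prescribes \<open>P\<close> on intervals of nonempty words only.\<close>

lemma norm_nadic_pvm_Cons:
  assumes "cuntz_representation N S" "nadic_pvm N S P" "k < N" "\<alpha> \<in> words N (Suc n)"
  shows "norm (P (nadic_interval N (k # \<alpha>)) g) = norm (P (nadic_interval N \<alpha>) (cadjoint (S k) g))"
proof -
  have "bounded_clinear (S k)" "cadjoint (S k) \<circ> S k = id"
    using assms(1,3) by (auto simp: cuntz_representation_def)
  moreover have "P (nadic_interval N \<beta>) = cuntz_range_projection S \<beta>"
    if "\<beta> = \<alpha> \<or> \<beta> = k # \<alpha>" for \<beta>
  proof -
    have "\<beta> \<noteq> []" "set \<beta> \<subseteq> {..<N}" using assms(3,4) that by (auto simp: words_def)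
    then show ?thesis using assms(2) by (simp add: nadic_pvm_def)
  qed
  ultimately show ?thesis
    by (simp add: cuntz_range_projection_Cons norm_isometry_of_cadjoint)
qed

theorem corollary2p5:
  fixes N :: nat
    and S :: "nat \<Rightarrow> 'h::chilbert_space \<Rightarrow> 'h"
    and P :: "real set \<Rightarrow> 'h \<Rightarrow> 'h"
    and f :: 'h
    and t :: real
  assumes "N \<ge> 2"
    and "cuntz_representation N S"
    and "nadic_pvm N S P"
  shows "char (pvm_measure P f) t =
    (\<Sum>k<N. iexp (real k * t / real N) * char (pvm_measure P (cadjoint (S k) f)) (t / real N))"
proof -
  define R where "R g u n = (\<Sum>\<alpha>\<in>words N n. iexp (u * nadic_left N \<alpha>)
    * (norm (P (nadic_interval N \<alpha>) g))\<^sup>2)" for g u n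
  have lim: "R g u \<longlonglongrightarrow> char (pvm_measure P g) u" for g u
    unfolding R_def using assms by (intro char_pvm_measure_LIMSEQ) (auto simp: nadic_pvm_def)
  have "iexp (t * nadic_left N (k # \<alpha>))
      = iexp (real k * t / real N) * iexp (t / real N * nadic_left N \<alpha>)" for k \<alpha>
    by (simp add: nadic_left_Cons nadic_map_def add_divide_distrib algebra_simps flip: exp_add)
  \<comment> \<open>One successor is the letter split off, the other keeps the remaining word
    nonempty.\<close>
  then have R_Suc: "R f t (Suc (Suc n)) = (\<Sum>k<N. iexp (real k * t / real N)
      * R (cadjoint (S k) f) (t / real N) (Suc n))" for n
    unfolding R_def sum_words_Suc[of _ N "Suc n"]
    by (auto intro!: sum.cong simp: norm_nadic_pvm_Cons[OF assms(2,3)] sum_distrib_left mult.assoc)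
  have "(\<lambda>n. R f t (Suc (Suc n))) \<longlonglongrightarrow> (\<Sum>k<N. iexp (real k * t / real N)
      * char (pvm_measure P (cadjoint (S k) f)) (t / real N))"
    unfolding R_Suc by (intro tendsto_intros LIMSEQ_Suc lim)
  moreover have "(\<lambda>n. R f t (Suc (Suc n))) \<longlonglongrightarrow> char (pvm_measure P f) t"
    by (intro LIMSEQ_Suc lim)
  ultimately show ?thesis by (rule LIMSEQ_unique[symmetric])
qed

end
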